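(* For every integer $n\ge2$, the number of idempotent residuated chains with $n$ elements, up to isomorphism, is $$\mathbf I(n)=\sum_{s=0}^{[\frac n2]-1}\ \sum_{t=0}^{[\frac n2]-1-s}2^{\,n-2(1+s+t)}\binom{n-2-s-t}{\,n-2(1+s+t),\ s,\ t\,}.$$
   Context: A residuated lattice is an algebra $\mathbf A=\langle A,\wedge,\vee,\cdot,\backslash,/,\mathrm e\rangle$ such that $\langle A,\wedge,\vee\rangle$ is a lattice, $\langle A,\cdot,\mathrm e\rangle$ is a monoid, and for all $a,b,c\in A$: $b\le a\backslash c\iff a\cdot b\le c\iff a\le c/b$. It is idempotent if $aa=a$ for all $a$, and a residuated chain if its lattice order is total (commutativity is not assumed). $[x]$ denotes the integer part of $x$, and $\binom{p+q+r}{p,q,r}=\frac{(p+q+r)!}{p!\,q!\,r!}$ is the multinomial coefficient. *)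

theory Defs
  imports "HOL-Algebra.Group"
begin

record 'a residuated_algebra = "'a monoid" +
  wedge :: "'a \<Rightarrow> 'a \<Rightarrow> 'a" (infixl \<open>\<curlywedge>\<index>\<close> 65)
  vee   :: "'a \<Rightarrow> 'a \<Rightarrow> 'a" (infixl \<open>\<curlyvee>\<index>\<close> 65)
  under :: "'a \<Rightarrow> 'a \<Rightarrow> 'a" (infixl \<open>\<setminus>\<index>\<close> 68)
  over  :: "'a \<Rightarrow> 'a \<Rightarrow> 'a" (infixl \<open>\<oslash>\<index>\<close> 68)

text \<open>The order of the lattice reduct.\<close>

definition rle :: "('a, 'm) residuated_algebra_scheme \<Rightarrow> 'a \<Rightarrow> 'a \<Rightarrow> bool"
    (infix \<open>\<preceq>\<index>\<close> 50)
  where "x \<preceq>\<^bsub>A\<^esub> y \<longleftrightarrow> x \<curlywedge>\<^bsub>A\<^esub> y = x"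

locale residuated_lattice = monoid A for A (structure) +
  assumes wedge_closed: "\<lbrakk>x \<in> carrier A; y \<in> carrier A\<rbrakk> \<Longrightarrow> x \<curlywedge> y \<in> carrier A"
    and vee_closed: "\<lbrakk>x \<in> carrier A; y \<in> carrier A\<rbrakk> \<Longrightarrow> x \<curlyvee> y \<in> carrier A"
    and under_closed: "\<lbrakk>x \<in> carrier A; y \<in> carrier A\<rbrakk> \<Longrightarrow> x \<setminus> y \<in> carrier A"
    and over_closed: "\<lbrakk>x \<in> carrier A; y \<in> carrier A\<rbrakk> \<Longrightarrow> x \<oslash> y \<in> carrier A"
    and wedge_comm: "\<lbrakk>x \<in> carrier A; y \<in> carrier A\<rbrakk> \<Longrightarrow> x \<curlywedge> y = y \<curlywedge> x"
    and vee_comm: "\<lbrakk>x \<in> carrier A; y \<in> carrier A\<rbrakk> \<Longrightarrow> x \<curlyvee> y = y \<curlyvee> x"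
    and wedge_assoc: "\<lbrakk>x \<in> carrier A; y \<in> carrier A; z \<in> carrier A\<rbrakk>
      \<Longrightarrow> (x \<curlywedge> y) \<curlywedge> z = x \<curlywedge> (y \<curlywedge> z)"
    and vee_assoc: "\<lbrakk>x \<in> carrier A; y \<in> carrier A; z \<in> carrier A\<rbrakk>
      \<Longrightarrow> (x \<curlyvee> y) \<curlyvee> z = x \<curlyvee> (y \<curlyvee> z)"
    and wedge_vee_absorb: "\<lbrakk>x \<in> carrier A; y \<in> carrier A\<rbrakk> \<Longrightarrow> x \<curlywedge> (x \<curlyvee> y) = x"
    and vee_wedge_absorb: "\<lbrakk>x \<in> carrier A; y \<in> carrier A\<rbrakk> \<Longrightarrow> x \<curlyvee> (x \<curlywedge> y) = x"
    and under_residual: "\<lbrakk>a \<in> carrier A; b \<in> carrier A; c \<in> carrier A\<rbrakk>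
      \<Longrightarrow> b \<preceq> a \<setminus> c \<longleftrightarrow> a \<otimes> b \<preceq> c"
    and over_residual: "\<lbrakk>a \<in> carrier A; b \<in> carrier A; c \<in> carrier A\<rbrakk>
      \<Longrightarrow> a \<preceq> c \<oslash> b \<longleftrightarrow> a \<otimes> b \<preceq> c"

locale residuated_chain = residuated_lattice +
  assumes rle_total: "\<lbrakk>x \<in> carrier A; y \<in> carrier A\<rbrakk> \<Longrightarrow> x \<preceq> y \<or> y \<preceq> x"

locale idempotent_residuated_chain = residuated_chain +
  assumes idempotent: "x \<in> carrier A \<Longrightarrow> x \<otimes> x = x"

text \<open>\<^const>\<open>iso\<close> consists of the bijections between the carriers that preserve the product.\<close>

definition rl_iso ::
  "('a, 'm) residuated_algebra_scheme \<Rightarrow> ('b, 'n) residuated_algebra_scheme \<Rightarrow> ('a \<Rightarrow> 'b) set"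
  where "rl_iso A B = {h \<in> iso A B. h \<one>\<^bsub>A\<^esub> = \<one>\<^bsub>B\<^esub> \<and>
    (\<forall>x\<in>carrier A. \<forall>y\<in>carrier A.
       h (x \<curlywedge>\<^bsub>A\<^esub> y) = h x \<curlywedge>\<^bsub>B\<^esub> h y \<and>
       h (x \<curlyvee>\<^bsub>A\<^esub> y) = h x \<curlyvee>\<^bsub>B\<^esub> h y \<and>
       h (x \<setminus>\<^bsub>A\<^esub> y) = h x \<setminus>\<^bsub>B\<^esub> h y \<and>
       h (x \<oslash>\<^bsub>A\<^esub> y) = h x \<oslash>\<^bsub>B\<^esub> h y)}"

text \<open>
  Every finite idempotent residuated chain is isomorphic to one on a set of natural numbers (see
  \<open>residuated_chain_on_nat\<close> below), so it suffices to classify those. There are infinitely many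
  records with a given \<open>n\<close>-element carrier, as the operations are unconstrained outside of it;
  isomorphism identifies those that agree on the carrier.
\<close>

definition irc_n :: "nat \<Rightarrow> nat residuated_algebra set"
  where "irc_n n = {A. idempotent_residuated_chain A \<and> finite (carrier A) \<and> card (carrier A) = n}"

definition irc_iso_rel :: "nat \<Rightarrow> nat residuated_algebra rel"
  where "irc_iso_rel n = {(A, B). A \<in> irc_n n \<and> B \<in> irc_n n \<and> rl_iso A B \<noteq> {}}"

definition num_irc :: "nat \<Rightarrow> nat"
  where "num_irc n = card (irc_n n // irc_iso_rel n)"

definition multinomial3 :: "nat \<Rightarrow> nat \<Rightarrow> nat \<Rightarrow> nat"
  where "multinomial3 p q r = fact (p + q + r) div (fact p * fact q * fact r)"

lemma rl_iso_id: "id \<in> rl_iso A A"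
  by (simp add: rl_iso_def iso_def hom_def bij_betw_def)

lemma rl_iso_comp:
  assumes "f \<in> rl_iso A B" "g \<in> rl_iso B C"
  shows "g \<circ> f \<in> rl_iso A C"
proof -
  have "f x \<in> carrier B" if "x \<in> carrier A" for x
    using assms(1) that by (auto simp: rl_iso_def iso_def hom_def)
  moreover have "g \<circ> f \<in> iso A C"
    using assms iso_set_trans by (auto simp: rl_iso_def)
  ultimately show ?thesis
    using assms by (auto simp: rl_iso_def)
qed

lemma (in residuated_lattice) rl_iso_inv:
  assumes f: "f \<in> rl_iso A B"
  shows "inv_into (carrier A) f \<in> rl_iso B A"
proof -
  let ?g = "inv_into (carrier A) f"
  have fi: "f \<in> iso A B" using f by (simp add: rl_iso_def)
  hence bij: "bij_betw f (carrier A) (carrier B)" by (simp add: iso_def)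
  have g_in: "?g y \<in> carrier A" and fg: "f (?g y) = y" if "y \<in> carrier B" for y
    using that bij by (auto simp: bij_betw_def inv_into_into f_inv_into_f)
  have gf: "?g (f x) = x" if "x \<in> carrier A" for x
    using that bij by (simp add: bij_betw_def inv_into_f_f)
  have "?g (x \<otimes>\<^bsub>B\<^esub> y) = ?g x \<otimes> ?g y" if xy: "x \<in> carrier B" "y \<in> carrier B" for x y
  proof -
    have "f (?g x \<otimes> ?g y) = x \<otimes>\<^bsub>B\<^esub> y"
      using fi g_in fg xy by (simp add: iso_def hom_def)
    thus ?thesis using gf[OF m_closed[OF g_in[OF xy(1)] g_in[OF xy(2)]]] by simp
  qed
  hence gi: "?g \<in> iso B A"
    using bij_betw_inv_into[OF bij] g_in by (simp add: iso_def hom_def)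
  have one: "?g \<one>\<^bsub>B\<^esub> = \<one>\<^bsub>A\<^esub>"
    using f gf[OF one_closed] by (simp add: rl_iso_def)
  have ops: "?g (x \<curlywedge>\<^bsub>B\<^esub> y) = ?g x \<curlywedge>\<^bsub>A\<^esub> ?g y \<and>
       ?g (x \<curlyvee>\<^bsub>B\<^esub> y) = ?g x \<curlyvee>\<^bsub>A\<^esub> ?g y \<and>
       ?g (x \<setminus>\<^bsub>B\<^esub> y) = ?g x \<setminus>\<^bsub>A\<^esub> ?g y \<and>
       ?g (x \<oslash>\<^bsub>B\<^esub> y) = ?g x \<oslash>\<^bsub>A\<^esub> ?g y" if xy: "x \<in> carrier B" "y \<in> carrier B" for x y
  proof -
    note c = g_in[OF xy(1)] g_in[OF xy(2)]
    have "f (?g x \<curlywedge> ?g y) = x \<curlywedge>\<^bsub>B\<^esub> y" "f (?g x \<curlyvee> ?g y) = x \<curlyvee>\<^bsub>B\<^esub> y"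
      "f (?g x \<setminus> ?g y) = x \<setminus>\<^bsub>B\<^esub> y" "f (?g x \<oslash> ?g y) = x \<oslash>\<^bsub>B\<^esub> y"
      using f c fg xy by (simp_all add: rl_iso_def)
    thus ?thesis
      using gf[OF wedge_closed[OF c]] gf[OF vee_closed[OF c]]
        gf[OF under_closed[OF c]] gf[OF over_closed[OF c]] by simp
  qed
  show ?thesis using gi one ops by (simp add: rl_iso_def)
qed

lemma equiv_irc_iso_rel: "equiv (irc_n n) (irc_iso_rel n)"
proof (rule equivI)
  show "irc_iso_rel n \<subseteq> irc_n n \<times> irc_n n" by (auto simp: irc_iso_rel_def)
  show "refl_on (irc_n n) (irc_iso_rel n)"
    using rl_iso_id by (fastforce simp: refl_on_def irc_iso_rel_def)
  have "residuated_lattice A" if "A \<in> irc_n n" for A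
    using that by (auto simp: irc_n_def idempotent_residuated_chain_def residuated_chain_def)
  thus "sym (irc_iso_rel n)"
    using residuated_lattice.rl_iso_inv by (fastforce simp: sym_def irc_iso_rel_def)
  show "trans (irc_iso_rel n)"
    using rl_iso_comp by (fastforce simp: trans_def irc_iso_rel_def)
qed

lemma (in idempotent_residuated_chain) residuated_chain_on_nat:
  assumes fin: "finite (carrier A)" and n: "card (carrier A) = n"
  shows "\<exists>B \<in> irc_n n. rl_iso A B \<noteq> {}"
proof -
  obtain f :: "'a \<Rightarrow> nat" where f: "bij_betw f (carrier A) {..<n}"
    using ex_bij_betw_finite_nat[OF fin] n by (auto simp: atLeast0LessThan)
  define g where "g = inv_into (carrier A) f"
  have g_in: "g y \<in> carrier A" if "y < n" for y
    using that f unfolding g_def bij_betw_def by (metis inv_into_into lessThan_iff)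
  have fg: "f (g y) = y" if "y < n" for y
    using that f unfolding g_def bij_betw_def by (metis f_inv_into_f lessThan_iff)
  have gf: "g (f x) = x" if "x \<in> carrier A" for x
    using that f unfolding g_def bij_betw_def by (simp add: inv_into_f_f)
  have f_in: "f x < n" if "x \<in> carrier A" for x
    using that f unfolding bij_betw_def by auto
  have f_eq: "f x = y \<longleftrightarrow> x = g y" if "x \<in> carrier A" "y < n" for x y
    using that gf fg by metis
  define B :: "nat residuated_algebra" where
    "B = \<lparr>carrier = {..<n}, mult = (\<lambda>x y. f (g x \<otimes> g y)), one = f \<one>,
      wedge = (\<lambda>x y. f (g x \<curlywedge> g y)), vee = (\<lambda>x y. f (g x \<curlyvee> g y)),
      under = (\<lambda>x y. f (g x \<setminus> g y)), over = (\<lambda>x y. f (g x \<oslash> g y))\<rparr>"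
  note cl = g_in fg gf f_in wedge_closed vee_closed under_closed over_closed
  have le: "x \<preceq>\<^bsub>B\<^esub> y \<longleftrightarrow> g x \<preceq> g y" if "x < n" "y < n" for x y
    using that by (simp add: rle_def B_def f_eq cl)
  have cB: "x \<in> carrier B \<longleftrightarrow> x < n" for x by (simp add: B_def)
  have "monoid B"
    by unfold_locales (auto simp: B_def cl m_assoc)
  hence "idempotent_residuated_chain B"
  proof (unfold idempotent_residuated_chain_def residuated_chain_def residuated_lattice_def
      residuated_lattice_axioms_def residuated_chain_axioms_def
      idempotent_residuated_chain_axioms_def cB, intro conjI allI impI)
    fix a b c assume h: "a < n" "b < n" "c < n"
    have 1: "a \<setminus>\<^bsub>B\<^esub> c < n" "c \<oslash>\<^bsub>B\<^esub> b < n" "a \<otimes>\<^bsub>B\<^esub> b < n"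
      using h by (simp_all add: B_def cl)
    have 2: "g (a \<setminus>\<^bsub>B\<^esub> c) = g a \<setminus> g c" "g (c \<oslash>\<^bsub>B\<^esub> b) = g c \<oslash> g b"
      "g (a \<otimes>\<^bsub>B\<^esub> b) = g a \<otimes> g b"
      using h by (simp_all add: B_def cl)
    show "b \<preceq>\<^bsub>B\<^esub> a \<setminus>\<^bsub>B\<^esub> c \<longleftrightarrow> a \<otimes>\<^bsub>B\<^esub> b \<preceq>\<^bsub>B\<^esub> c"
      using h 1 2 by (simp add: le under_residual g_in)
    show "a \<preceq>\<^bsub>B\<^esub> c \<oslash>\<^bsub>B\<^esub> b \<longleftrightarrow> a \<otimes>\<^bsub>B\<^esub> b \<preceq>\<^bsub>B\<^esub> c"
      using h 1 2 by (simp add: le over_residual g_in)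
  next
    fix x y assume "x < n" "y < n"
    thus "x \<preceq>\<^bsub>B\<^esub> y \<or> y \<preceq>\<^bsub>B\<^esub> x" by (simp add: le rle_total g_in)
    show "x \<curlywedge>\<^bsub>B\<^esub> y = y \<curlywedge>\<^bsub>B\<^esub> x" "x \<curlyvee>\<^bsub>B\<^esub> y = y \<curlyvee>\<^bsub>B\<^esub> x"
      using \<open>x < n\<close> \<open>y < n\<close> wedge_comm[of "g x" "g y"] vee_comm[of "g x" "g y"]
      by (simp_all add: B_def g_in)
  qed (simp_all add: B_def cl wedge_assoc vee_assoc wedge_vee_absorb vee_wedge_absorb idempotent)
  hence "B \<in> irc_n n" by (simp add: irc_n_def B_def)
  moreover have "f \<in> rl_iso A B"
    using f by (auto simp: rl_iso_def iso_def hom_def B_def cl)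
  ultimately show ?thesis by blast
qed

end

theory Submission
  imports Defs
begin

text \<open>
  The product of an idempotent ordered monoid on a chain is conservative: \<open>x y\<close> is \<open>x\<close> or \<open>y\<close>. If
  \<open>l < h\<close> are the bounds of such a chain, the values of \<open>l h\<close> and \<open>h l\<close> leave four cases: \<open>l\<close> is a
  zero, \<open>h\<close> is a zero, or \<open>{l, h}\<close> is a left-zero or a right-zero band that absorbs everything in
  between. Removing the zero (one element) or the band (two elements) leaves an arbitrary chain of
  this kind, so the number \<open>c N\<close> of those with \<open>N + 1\<close> elements satisfies
  \<open>c (N + 2) = 2 c (N + 1) + 2 c N\<close>. A finite chain of this kind is residuated iff its bottom is a
  zero; removing that zero shows that the number sought is \<open>c (n - 2)\<close>.

  A finite chain with a distinguished element has a unique order isomorphism onto an integer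
  interval that takes the element to 0. Isomorphism classes thus correspond to multiplication tables
  on intervals \<open>{l..h}\<close> with unit 0; extending the chain then needs no renumbering.
\<close>

section \<open>Multiplication tables on integer intervals\<close>

text \<open>The default value in \<open>outside\<close> makes a table determined by its values on
  the interval, so tables can be counted up to plain equality of functions.\<close>

locale idempotent_chain_table =
  fixes l h :: int and f :: "int \<Rightarrow> int \<Rightarrow> int"
  assumes bounds: "l \<le> 0" "0 \<le> h"
    and closed: "\<lbrakk>x \<in> {l..h}; y \<in> {l..h}\<rbrakk> \<Longrightarrow> f x y \<in> {l..h}"
    and unit_left: "x \<in> {l..h} \<Longrightarrow> f 0 x = x"
    and unit_right: "x \<in> {l..h} \<Longrightarrow> f x 0 = x"
    and assoc: "\<lbrakk>x \<in> {l..h}; y \<in> {l..h}; z \<in> {l..h}\<rbrakk> \<Longrightarrow> f (f x y) z = f x (f y z)"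
    and idem: "x \<in> {l..h} \<Longrightarrow> f x x = x"
    and mono_left: "\<lbrakk>x \<in> {l..h}; y \<in> {l..h}; z \<in> {l..h}; x \<le> y\<rbrakk> \<Longrightarrow> f x z \<le> f y z"
    and mono_right: "\<lbrakk>x \<in> {l..h}; y \<in> {l..h}; z \<in> {l..h}; x \<le> y\<rbrakk> \<Longrightarrow> f z x \<le> f z y"
    and outside: "\<not> (x \<in> {l..h} \<and> y \<in> {l..h}) \<Longrightarrow> f x y = 0"
begin

lemma zero_mem: "0 \<in> {l..h}"
  using bounds by simp

text \<open>Below the unit, monotonicity puts a product under both factors; idempotence of the
  smaller factor, again with monotonicity, gives the reverse bound.\<close>

lemma mult_nonpos:
  assumes "x \<in> {l..h}" "y \<in> {l..h}" "x \<le> 0" "y \<le> 0"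
  shows "f x y = min x y"
proof (rule antisym)
  show "f x y \<le> min x y"
    using mono_left[of x 0 y] mono_right[of y 0 x] unit_left unit_right assms zero_mem by auto
  have "f (min x y) (min x y) \<le> f x (min x y)" "f x (min x y) \<le> f x y"
    using assms by (auto intro!: mono_left mono_right)
  thus "min x y \<le> f x y"
    using idem[of "min x y"] assms by (simp add: min_def split: if_splits)
qed

lemma mult_nonneg:
  assumes "x \<in> {l..h}" "y \<in> {l..h}" "0 \<le> x" "0 \<le> y"
  shows "f x y = max x y"
proof (rule antisym)
  show "max x y \<le> f x y"
    using mono_left[of 0 x y] mono_right[of 0 y x] unit_left unit_right assms zero_mem by auto
  have "f x y \<le> f x (max x y)" "f x (max x y) \<le> f (max x y) (max x y)"
    using assms by (auto intro!: mono_left mono_right)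
  thus "f x y \<le> max x y"
    using idem[of "max x y"] assms by (simp add: max_def split: if_splits)
qed

text \<open>Idempotence and associativity give \<open>x(xy) = xy = (xy)y\<close>. If the factors lie
  on different sides of the unit, the product is compared with the factor on its own side: there
  multiplication is \<open>min\<close> or \<open>max\<close>, which yields one inequality, and
  monotonicity yields the other.\<close>

lemma conservative:
  assumes x: "x \<in> {l..h}" and y: "y \<in> {l..h}"
  shows "f x y \<in> {x, y}"
proof -
  have xy: "f x y \<in> {l..h}" using closed x y .
  have absorb_left: "f x (f x y) = f x y" using assoc[of x x y] idem x y by simp
  have absorb_right: "f (f x y) y = f x y" using assoc[of x y y] idem x y by simp
  show ?thesis
  proof (cases "f x y \<le> 0")
    case True
    consider "x \<le> 0" "y \<le> 0" | "x \<le> 0" "0 \<le> y" | "0 \<le> x" "y \<le> 0" | "0 < x" "0 < y" by linarith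
    thus ?thesis
    proof cases
      case 1 thus ?thesis using mult_nonpos x y by auto
    next
      case 2
      have "x \<le> f x y"
        using mono_right[of 0 y x] unit_right 2 x y zero_mem by auto
      thus ?thesis using absorb_left mult_nonpos[OF x xy] True 2 by auto
    next
      case 3
      have "y \<le> f x y"
        using mono_left[of 0 x y] unit_left 3 x y zero_mem by auto
      thus ?thesis using absorb_right mult_nonpos[OF xy y] True 3 by auto
    next
      case 4 thus ?thesis using mult_nonneg x y by auto
    qed
  next
    case False
    consider "x \<le> 0" "y \<le> 0" | "x \<le> 0" "0 \<le> y" | "0 \<le> x" "y \<le> 0" | "0 < x" "0 < y" by linarith
    thus ?thesis
    proof cases
      case 1 thus ?thesis using mult_nonpos x y by auto
    next
      case 2
      have "f x y \<le> y"
        using mono_left[of x 0 y] unit_left 2 x y zero_mem by auto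
      thus ?thesis using absorb_right mult_nonneg[OF xy y] False 2 by auto
    next
      case 3
      have "f x y \<le> x"
        using mono_right[of y 0 x] unit_right 3 x y zero_mem by auto
      thus ?thesis using absorb_left mult_nonneg[OF x xy] False 3 by auto
    next
      case 4 thus ?thesis using mult_nonneg x y by auto
    qed
  qed
qed

text \<open>This symmetry reduces the right-zero corner case to the left-zero one.\<close>

lemma opposite: "idempotent_chain_table l h (\<lambda>x y. f y x)"
  by unfold_locales
    (use bounds closed unit_left unit_right assoc idem mono_left mono_right outside in auto)

text \<open>The products \<open>f l x\<close> and \<open>f x l\<close> are squeezed between
  \<open>l\<close> and the corner values. The unit cannot be \<open>l\<close>, since then
  \<open>f l h\<close> would be \<open>h\<close>.\<close>

lemma corners_bottom:
  assumes "l < h" "f l h = l" "f h l = l"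
  shows "l < 0" and "x \<in> {l..h} \<Longrightarrow> f l x = l" and "x \<in> {l..h} \<Longrightarrow> f x l = l"
proof -
  show "l < 0"
    using assms unit_left[of h] bounds by (cases "l = 0") auto
  assume x: "x \<in> {l..h}"
  show "f l x = l"
    using mono_right[of x h l] closed[of l x] x assms by auto
  show "f x l = l"
    using mono_left[of x h l] closed[of x l] x assms by auto
qed

lemma corners_top:
  assumes "l < h" "f l h = h" "f h l = h"
  shows "0 < h" and "x \<in> {l..h} \<Longrightarrow> f h x = h" and "x \<in> {l..h} \<Longrightarrow> f x h = h"
proof -
  show "0 < h"
    using assms unit_left[of l] bounds by (cases "h = 0") auto
  assume x: "x \<in> {l..h}"
  show "f h x = h"
    using mono_right[of l x h] closed[of h x] x assms by auto
  show "f x h = h"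
    using mono_left[of l x h] closed[of x h] x assms by auto
qed

text \<open>Squeezing settles the rows of \<open>l\<close> and \<open>h\<close>; the columns need
  associativity as well. The last two claims exclude the end points because \<open>f h l = h\<close>
  and \<open>f l h = l\<close>.\<close>

lemma corners_left_zero:
  assumes lh: "l < h" and c: "f l h = l" "f h l = h"
  shows "l < 0" and "0 < h"
    and "x \<in> {l..h} \<Longrightarrow> f l x = l" and "x \<in> {l..h} \<Longrightarrow> f h x = h"
    and "x \<in> {l<..<h} \<Longrightarrow> f x l = l" and "x \<in> {l<..<h} \<Longrightarrow> f x h = h"
proof -
  show "l < 0"
    using assms unit_left[of h] bounds by (cases "l = 0") auto
  show "0 < h"
    using assms unit_left[of l] bounds by (cases "h = 0") auto
  have mem: "l \<in> {l..h}" "h \<in> {l..h}" using lh by auto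
  show "f l x = l" if "x \<in> {l..h}"
    using mono_right[of x h l] closed[of l x] that assms by auto
  show "f h x = h" if "x \<in> {l..h}"
    using mono_right[of l x h] closed[of h x] that assms by auto
  assume x': "x \<in> {l<..<h}"
  hence x: "x \<in> {l..h}" by simp
  have 1: "f (f x l) h = f x l" using assoc[OF x mem] c by simp
  have 2: "f (f x h) l = f x h" using assoc[OF x mem(2,1)] c by simp
  show "f x l = l"
  proof (cases "0 \<le> x")
    case True
    thus ?thesis
      using conservative[OF x mem(1)] mult_nonneg[OF x mem(2)] 1 x' bounds by auto
  next
    case False
    thus ?thesis using mult_nonpos[OF x mem(1)] x' bounds by auto
  qed
  show "f x h = h"
  proof (cases "0 \<le> x")
    case True
    thus ?thesis using mult_nonneg[OF x mem(2)] x' bounds by auto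
  next
    case False
    thus ?thesis
      using conservative[OF x mem(2)] mult_nonpos[OF x mem(1)] 2 x' bounds by auto
  qed
qed

end

section \<open>Removing and adjoining extreme elements\<close>

definition restrict_table :: "int \<Rightarrow> int \<Rightarrow> (int \<Rightarrow> int \<Rightarrow> int) \<Rightarrow> int \<Rightarrow> int \<Rightarrow> int"
  where "restrict_table l h f x y = (if x \<in> {l..h} \<and> y \<in> {l..h} then f x y else 0)"

text \<open>With one new element this adjoins a zero. With one at each end the new elements form a
  left-zero band, because a new left factor takes precedence over a new right one.\<close>

definition extend_table ::
    "int \<Rightarrow> int \<Rightarrow> int \<Rightarrow> int \<Rightarrow> (int \<Rightarrow> int \<Rightarrow> int) \<Rightarrow> int \<Rightarrow> int \<Rightarrow> int"
  where "extend_table l' h' l h f x y =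
    (if x \<in> {l..h} \<and> y \<in> {l..h} then f x y
     else if x \<in> {l'..h'} \<and> y \<in> {l'..h'} then (if x \<in> {l..h} then y else x)
     else 0)"

text \<open>By conservativity every subinterval is closed under the product, and the unit is kept by
  assumption.\<close>

lemma (in idempotent_chain_table) restrict_table:
  assumes "l \<le> l'" "l' \<le> 0" "0 \<le> h'" "h' \<le> h"
  shows "idempotent_chain_table l' h' (restrict_table l' h' f)"
proof -
  have mem: "x \<in> {l..h}" if "x \<in> {l'..h'}" for x using that assms by auto
  have cl: "f x y \<in> {l'..h'}" if "x \<in> {l'..h'}" "y \<in> {l'..h'}" for x y
    using conservative[of x y] that mem by auto
  show ?thesis
  proof
    fix x y assume "x \<in> {l'..h'}" "y \<in> {l'..h'}"
    thus "restrict_table l' h' f x y \<in> {l'..h'}"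
      using cl by (simp add: restrict_table_def)
  next
    fix x y z assume "x \<in> {l'..h'}" "y \<in> {l'..h'}" "z \<in> {l'..h'}"
    thus "restrict_table l' h' f (restrict_table l' h' f x y) z =
        restrict_table l' h' f x (restrict_table l' h' f y z)"
      unfolding restrict_table_def using cl assoc mem by presburger
  qed (use assms unit_left unit_right idem mono_left mono_right in \<open>auto simp: restrict_table_def\<close>)
qed

text \<open>At most one element is added at each end, so a new element is the minimum or the maximum
  of the larger interval. This keeps absorption monotone: two elements added at the bottom as a
  left-zero band would already violate it.\<close>

lemma (in idempotent_chain_table) extend_table:
  assumes "l - 1 \<le> l'" "l' \<le> l" "h \<le> h'" "h' \<le> h + 1"
  shows "idempotent_chain_table l' h' (extend_table l' h' l h f)"
proof -
  have new: "x = l' \<and> l' = l - 1 \<or> x = h' \<and> h' = h + 1"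
    if "x \<in> {l'..h'}" "x \<notin> {l..h}" for x
    using that assms by auto
  have mem: "x \<in> {l'..h'}" if "x \<in> {l..h}" for x using that assms by auto
  let ?g = "extend_table l' h' l h f"
  have g_in: "?g x y = f x y" if "x \<in> {l..h}" "y \<in> {l..h}" for x y
    using that by (simp add: extend_table_def)
  have g_l: "?g x y = x" if "x \<in> {l'..h'}" "x \<notin> {l..h}" "y \<in> {l'..h'}" for x y
    using that by (simp only: extend_table_def if_False if_True simp_thms)
  have g_r: "?g x y = y" if "x \<in> {l..h}" "y \<in> {l'..h'}" "y \<notin> {l..h}" for x y
    using that mem[OF that(1)] by (simp only: extend_table_def if_False if_True simp_thms)
  have cl: "?g x y \<in> {l'..h'}" if "x \<in> {l'..h'}" "y \<in> {l'..h'}" for x y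
  proof -
    consider "x \<in> {l..h}" "y \<in> {l..h}" | "x \<in> {l..h}" "y \<notin> {l..h}" | "x \<notin> {l..h}" by blast
    thus ?thesis
    proof cases
      case 1 thus ?thesis using g_in closed mem by simp
    next
      case 2 thus ?thesis using g_r that by simp
    next
      case 3 thus ?thesis using g_l that by simp
    qed
  qed
  show ?thesis
  proof
    fix x y z assume xyz: "x \<in> {l'..h'}" "y \<in> {l'..h'}" "z \<in> {l'..h'}"
    \<comment> \<open>A product with a new factor equals its leftmost new factor under either
      bracketing, so only three old factors need the original associativity.\<close>
    show "?g (?g x y) z = ?g x (?g y z)"
    proof (cases "x \<in> {l..h}")
      case x: True
      show ?thesis
      proof (cases "y \<in> {l..h}")
        case y: True
        show ?thesis
          using x y xyz g_in g_r closed[OF x y] closed[OF y] assoc[OF x y] by metis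
      next
        case False
        thus ?thesis using x xyz g_r g_l by metis
      qed
    next
      case False
      thus ?thesis using xyz g_l cl by metis
    qed
    assume le: "x \<le> y"
    show "?g x z \<le> ?g y z"
    proof (cases "x \<in> {l..h} \<and> y \<in> {l..h}")
      case True
      thus ?thesis using xyz g_in g_r mono_left[OF _ _ _ le] by (metis order_refl)
    next
      case False
      \<comment> \<open>A new top \<open>x\<close> forces \<open>y = h'\<close>, and a new bottom
        \<open>y\<close> forces \<open>x = l'\<close>. One of the two products is then an end of the
        interval, so the inequality follows from closure alone.\<close>
      have "x = l' \<and> x \<notin> {l..h} \<or> y = h' \<and> y \<notin> {l..h}"
        using False new xyz le assms by fastforce
      thus ?thesis using g_l[of x z] g_l[of y z] cl xyz by (metis atLeastAtMost_iff)
    qed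
    show "?g z x \<le> ?g z y"
    proof (cases "z \<in> {l..h}")
      case z: True
      show ?thesis
      proof (cases "x \<in> {l..h} \<and> y \<in> {l..h}")
        case True
        thus ?thesis using z g_in mono_right[OF _ _ _ le] by metis
      next
        case False
        have "x = l' \<and> x \<notin> {l..h} \<or> y = h' \<and> y \<notin> {l..h}"
          using False new xyz le assms by fastforce
        thus ?thesis using g_r[OF z, of x] g_r[OF z, of y] cl xyz by (metis atLeastAtMost_iff)
      qed
    next
      case False
      thus ?thesis using g_l xyz by simp
    qed
  qed (use assms bounds cl unit_left unit_right idem in \<open>auto simp: extend_table_def\<close>)
qed

text \<open>The interval has \<open>N + 1\<close> elements. Its end points belong to the datum
  because they fix the place of the unit.\<close>

definition tables :: "nat \<Rightarrow> (int \<times> int \<times> (int \<Rightarrow> int \<Rightarrow> int)) set"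
  where "tables N = {(l, h, f). idempotent_chain_table l h f \<and> h - l = int N}"

text \<open>
  In \<open>peelable d e\<close> the lowest \<open>d\<close> and the highest \<open>e\<close> elements absorb all others and form a
  left-zero band; \<open>d\<close> and \<open>e\<close> are 0 or 1.
\<close>

definition peelable :: "nat \<Rightarrow> nat \<Rightarrow> nat \<Rightarrow> (int \<times> int \<times> (int \<Rightarrow> int \<Rightarrow> int)) set"
  where "peelable d e N = {(l, h, f) \<in> tables N. l + int d \<le> 0 \<and> 0 \<le> h - int e \<and>
    (\<forall>x\<in>{l..h} - {l + int d..h - int e}. \<forall>y\<in>{l..h}.
      f x y = x \<and> (y \<in> {l + int d..h - int e} \<longrightarrow> f y x = x))}"

definition peel ::
    "nat \<Rightarrow> nat \<Rightarrow> int \<times> int \<times> (int \<Rightarrow> int \<Rightarrow> int) \<Rightarrow> int \<times> int \<times> (int \<Rightarrow> int \<Rightarrow> int)"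
  where "peel d e = (\<lambda>(l, h, f).
    (l + int d, h - int e, restrict_table (l + int d) (h - int e) f))"

text \<open>The conditions in \<open>peelable\<close> prescribe every product that involves a
  removed element, so restriction loses no information and \<open>extend_table\<close> is its
  inverse.\<close>

lemma bij_betw_peel:
  assumes de: "d \<le> 1" "e \<le> 1"
  shows "bij_betw (peel d e) (peelable d e (N + d + e)) (tables N)"
proof (rule bij_betw_byWitness[where f' = "\<lambda>(l, h, f).
    (l - int d, h + int e, extend_table (l - int d) (h + int e) l h f)"]; (intro ballI image_subsetI)?)
  fix a assume a: "a \<in> peelable d e (N + d + e)"
  obtain l h f where lhf: "a = (l, h, f)" by (cases a)
  interpret idempotent_chain_table l h f
    using a lhf by (auto simp: peelable_def tables_def)
  have "extend_table l h (l + int d) (h - int e) (restrict_table (l + int d) (h - int e) f) x y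
      = f x y" for x y
    using a outside[of x y] unfolding lhf extend_table_def restrict_table_def peelable_def by auto
  thus "(case peel d e a of (l, h, f) \<Rightarrow>
      (l - int d, h + int e, extend_table (l - int d) (h + int e) l h f)) = a"
    by (simp add: peel_def lhf fun_eq_iff)
  show "peel d e a \<in> tables N"
    using a restrict_table[of "l + int d" "h - int e"]
    by (auto simp: lhf peel_def peelable_def tables_def)
next
  fix a assume a: "a \<in> tables N"
  obtain l h f where lhf: "a = (l, h, f)" by (cases a)
  interpret idempotent_chain_table l h f
    using a lhf by (auto simp: tables_def)
  have "restrict_table l h (extend_table (l - int d) (h + int e) l h f) x y = f x y" for x y
    using outside[of x y] by (auto simp: extend_table_def restrict_table_def)
  thus "peel d e (case a of (l, h, f) \<Rightarrow>
      (l - int d, h + int e, extend_table (l - int d) (h + int e) l h f)) = a"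
    by (simp add: peel_def lhf fun_eq_iff)
  show "(case a of (l, h, f) \<Rightarrow>
      (l - int d, h + int e, extend_table (l - int d) (h + int e) l h f))
      \<in> peelable d e (N + d + e)"
    using a bounds extend_table[of "l - int d" "h + int e"] de
    by (auto simp: lhf peelable_def tables_def extend_table_def)
qed

section \<open>Corner products and the recursion for the number of tables\<close>

lemma peelable_bottom:
  "peelable 1 0 (Suc N) = {(l, h, f) \<in> tables (Suc N). f l h = l \<and> f h l = l}"
proof -
  have "(l, h, f) \<in> peelable 1 0 (Suc N) \<longleftrightarrow> (l, h, f) \<in> tables (Suc N) \<and> f l h = l \<and> f h l = l" for l h f
  proof (rule iffI; (elim conjE)?)
    assume "(l, h, f) \<in> peelable 1 0 (Suc N)"
    thus "(l, h, f) \<in> tables (Suc N) \<and> f l h = l \<and> f h l = l"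
      by (auto simp: peelable_def tables_def)
  next
    assume t: "(l, h, f) \<in> tables (Suc N)" and c: "f l h = l" "f h l = l"
    then interpret idempotent_chain_table l h f by (simp add: tables_def)
    have "l < h" using t by (simp add: tables_def)
    note b = corners_bottom[OF this c]
    have "x = l" if "x \<in> {l..h} - {l + 1..h}" for x using that by auto
    thus "(l, h, f) \<in> peelable 1 0 (Suc N)"
      using t b bounds by (fastforce simp: peelable_def)
  qed
  thus ?thesis by auto
qed

lemma peelable_top:
  "peelable 0 1 (Suc N) = {(l, h, f) \<in> tables (Suc N). f l h = h \<and> f h l = h}"
proof -
  have "(l, h, f) \<in> peelable 0 1 (Suc N) \<longleftrightarrow> (l, h, f) \<in> tables (Suc N) \<and> f l h = h \<and> f h l = h" for l h f
  proof (rule iffI; (elim conjE)?)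
    assume "(l, h, f) \<in> peelable 0 1 (Suc N)"
    thus "(l, h, f) \<in> tables (Suc N) \<and> f l h = h \<and> f h l = h"
      by (auto simp: peelable_def tables_def)
  next
    assume t: "(l, h, f) \<in> tables (Suc N)" and c: "f l h = h" "f h l = h"
    then interpret idempotent_chain_table l h f by (simp add: tables_def)
    have "l < h" using t by (simp add: tables_def)
    note b = corners_top[OF this c]
    have "x = h" if "x \<in> {l..h} - {l..h - 1}" for x using that by auto
    thus "(l, h, f) \<in> peelable 0 1 (Suc N)"
      using t b bounds by (fastforce simp: peelable_def)
  qed
  thus ?thesis by auto
qed

text \<open>As in the two zero cases, the corner products alone force all absorption laws, here by
  \<open>corners_left_zero\<close>.\<close>

lemma peelable_both:
  "peelable 1 1 (Suc N) = {(l, h, f) \<in> tables (Suc N). f l h = l \<and> f h l = h}"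
proof -
  have "(l, h, f) \<in> peelable 1 1 (Suc N) \<longleftrightarrow> (l, h, f) \<in> tables (Suc N) \<and> f l h = l \<and> f h l = h" for l h f
  proof (rule iffI; (elim conjE)?)
    assume "(l, h, f) \<in> peelable 1 1 (Suc N)"
    thus "(l, h, f) \<in> tables (Suc N) \<and> f l h = l \<and> f h l = h"
      by (auto simp: peelable_def tables_def)
  next
    assume t: "(l, h, f) \<in> tables (Suc N)" and c: "f l h = l" "f h l = h"
    then interpret idempotent_chain_table l h f by (simp add: tables_def)
    have "l < h" using t by (simp add: tables_def)
    note b = corners_left_zero[OF this c]
    have "x = l \<or> x = h" if "x \<in> {l..h} - {l + 1..h - 1}" for x using that by auto
    thus "(l, h, f) \<in> peelable 1 1 (Suc N)"
      using t b bounds by (fastforce simp: peelable_def)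
  qed
  thus ?thesis by auto
qed

text \<open>Reversing the multiplication swaps the two mixed corner patterns and is its own
  inverse.\<close>

lemma bij_betw_opposite:
  "bij_betw (\<lambda>(l, h, f). (l, h, \<lambda>x y. f y x)) (peelable 1 1 (Suc N))
    {(l, h, f) \<in> tables (Suc N). f l h = h \<and> f h l = l}"
  unfolding peelable_both
  by (rule bij_betw_byWitness[where f' = "\<lambda>(l, h, f). (l, h, \<lambda>x y. f y x)"])
    (auto simp: tables_def idempotent_chain_table.opposite)

lemma tables_Suc:
  "tables (Suc N) = peelable 1 0 (Suc N) \<union> peelable 0 1 (Suc N) \<union> peelable 1 1 (Suc N) \<union>
    {(l, h, f) \<in> tables (Suc N). f l h = h \<and> f h l = l}" (is "_ = ?R")
proof
  show "tables (Suc N) \<subseteq> ?R"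
  proof clarify
    fix l h f assume t: "(l, h, f) \<in> tables (Suc N)"
      and "(l, h, f) \<notin> peelable 1 0 (Suc N)" "(l, h, f) \<notin> peelable 0 1 (Suc N)"
        "(l, h, f) \<notin> peelable 1 1 (Suc N)"
    moreover have "f l h \<in> {l, h}" "f h l \<in> {h, l}"
      using t idempotent_chain_table.conservative[of l h f] by (auto simp: tables_def)
    ultimately show "f l h = h \<and> f h l = l"
      unfolding peelable_bottom peelable_top peelable_both by auto
  qed
qed (auto simp: peelable_def)

text \<open>The four corner patterns partition the tables. The left-zero case stays unevaluated
  because removing its two elements leads to \<open>N - 1\<close>, which does not exist for
  \<open>N = 0\<close>.\<close>

lemma card_tables_Suc:
  assumes "finite (tables N)" "finite (peelable 1 1 (Suc N))"
  shows "finite (tables (Suc N))"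
    and "card (tables (Suc N)) = 2 * card (tables N) + 2 * card (peelable 1 1 (Suc N))"
proof -
  define A B C D where "A = peelable 1 0 (Suc N)" and "B = peelable 0 1 (Suc N)"
    and "C = peelable 1 1 (Suc N)" and "D = {(l, h, f) \<in> tables (Suc N). f l h = h \<and> f h l = l}"
  have A: "bij_betw (peel 1 0) A (tables N)" and B: "bij_betw (peel 0 1) B (tables N)"
    using bij_betw_peel[of 1 0 N] bij_betw_peel[of 0 1 N] by (simp_all add: A_def B_def)
  have D: "bij_betw (\<lambda>(l, h, f). (l, h, \<lambda>x y. f y x)) C D"
    unfolding C_def D_def by (rule bij_betw_opposite)
  have fin: "finite A" "finite B" "finite C" "finite D"
    using bij_betw_finite[OF A] bij_betw_finite[OF B] bij_betw_finite[OF D] assms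
    unfolding C_def by blast+
  have T: "tables (Suc N) = A \<union> B \<union> C \<union> D"
    unfolding A_def B_def C_def D_def by (rule tables_Suc)
  show "finite (tables (Suc N))"
    unfolding T using fin by blast
  \<comment> \<open>Distinct bounds make the four corner patterns mutually exclusive.\<close>
  have ne: "l \<noteq> h" if "(l, h, f) \<in> tables (Suc N)" for l h f
    using that by (simp add: tables_def)
  have disj: "A \<inter> B = {}" "(A \<union> B) \<inter> C = {}" "(A \<union> B \<union> C) \<inter> D = {}"
    unfolding A_def B_def C_def D_def peelable_bottom peelable_top peelable_both
    by (safe; metis ne)+
  show "card (tables (Suc N)) = 2 * card (tables N) + 2 * card (peelable 1 1 (Suc N))"
    unfolding T C_def[symmetric]
    using bij_betw_same_card[OF A] bij_betw_same_card[OF B] bij_betw_same_card[OF D]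
    by (simp add: card_Un_disjoint fin disj)
qed

lemma tables_0: "tables 0 = {(0, 0, \<lambda>_ _. 0)}"
proof -
  have "idempotent_chain_table 0 0 (\<lambda>_ _. 0)" by unfold_locales auto
  moreover have "l = 0 \<and> h = 0 \<and> f = (\<lambda>_ _. 0)" if "idempotent_chain_table l h f" "h - l = 0" for l h f
  proof -
    interpret idempotent_chain_table l h f by fact
    have "l = 0" "h = 0" using bounds that by auto
    moreover have "f x y = 0" for x y
      using outside[of x y] unit_left[of 0] \<open>l = 0\<close> \<open>h = 0\<close> by (cases "x = 0 \<and> y = 0") auto
    ultimately show ?thesis by auto
  qed
  ultimately show ?thesis unfolding tables_def by fastforce
qed

text \<open>Removing both elements of a two-element interval would leave no room for the
  unit.\<close>

lemma peelable_both_1: "peelable 1 1 (Suc 0) = {}"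
  by (auto simp: peelable_def tables_def)

lemma card_tables_rec:
  shows "card (tables 0) = 1" and "card (tables (Suc 0)) = 2"
    and "card (tables (Suc (Suc N))) = 2 * card (tables (Suc N)) + 2 * card (tables N)"
proof -
  have both: "bij_betw (peel 1 1) (peelable 1 1 (Suc (Suc M))) (tables M)" for M
    using bij_betw_peel[of 1 1 M] by simp
  \<comment> \<open>The recursion has order two, so the induction carries two consecutive
    sizes.\<close>
  have fin: "finite (tables M) \<and> finite (tables (Suc M))" for M
  proof (induction M)
    case 0
    show ?case using card_tables_Suc(1)[of 0] by (simp add: tables_0 peelable_both_1[simplified])
  next
    case (Suc M)
    thus ?case using card_tables_Suc(1)[of "Suc M"] both[of M] by (simp add: bij_betw_finite)
  qed
  show "card (tables 0) = 1" by (simp add: tables_0)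
  show "card (tables (Suc 0)) = 2"
    using card_tables_Suc(2)[of 0] by (simp add: tables_0 peelable_both_1[simplified])
  show "card (tables (Suc (Suc N))) = 2 * card (tables (Suc N)) + 2 * card (tables N)"
    using card_tables_Suc(2)[of "Suc N"] fin both[of N]
    by (simp add: bij_betw_finite bij_betw_same_card)
qed

section \<open>The closed formula\<close>

text \<open>The summand counts the ways to write \<open>N\<close> as an ordered sum of
  \<open>N - j\<close> parts 1 and 2, exactly \<open>j\<close> of them equal to 2, with two kinds of
  each part. This matches the two coefficients 2 of the recursion.\<close>

lemma card_tables: "card (tables N) = (\<Sum>j\<le>N. 2 ^ (N - j) * ((N - j) choose j))"
proof (induction N rule: induct_nat_012)
  case (ge2 N)
  let ?F = "\<lambda>N j. 2 ^ (N - j) * ((N - j) choose j) :: nat"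
  have top: "(\<Sum>j\<le>Suc N. ?F (Suc N) j) = ?F (Suc N) 0 + (\<Sum>j\<le>N. ?F (Suc N) (Suc j))"
    by (rule sum.atMost_Suc_shift)
  \<comment> \<open>This is Pascal's rule multiplied by a power of two; \<open>j = N\<close> is
    separate because of truncated subtraction.\<close>
  have eq: "?F (Suc (Suc N)) (Suc j) = 2 * ?F (Suc N) (Suc j) + 2 * ?F N j" if "j \<le> N" for j
  proof (cases "j = N")
    case False
    with that have "N - j = Suc (N - Suc j)" by simp
    thus ?thesis by (simp add: Suc_diff_le algebra_simps)
  qed (cases N; simp)
  have "(\<Sum>j\<le>Suc (Suc N). ?F (Suc (Suc N)) j)
      = ?F (Suc (Suc N)) 0 + (\<Sum>j\<le>Suc N. ?F (Suc (Suc N)) (Suc j))"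
    by (rule sum.atMost_Suc_shift)
  \<comment> \<open>The dropped term has the factor \<open>0 choose Suc (Suc N)\<close>, which is
    0.\<close>
  also have "\<dots> = ?F (Suc (Suc N)) 0 + (\<Sum>j\<le>N. ?F (Suc (Suc N)) (Suc j))" by simp
  also have "(\<Sum>j\<le>N. ?F (Suc (Suc N)) (Suc j)) = (\<Sum>j\<le>N. 2 * ?F (Suc N) (Suc j) + 2 * ?F N j)"
    by (rule sum.cong) (use eq in auto)
  also have "\<dots> = 2 * (\<Sum>j\<le>N. ?F (Suc N) (Suc j)) + 2 * (\<Sum>j\<le>N. ?F N j)"
    by (simp only: sum.distrib sum_distrib_left)
  finally show ?case
    using top ge2 card_tables_rec(3)[of N] by simp
qed (simp_all add: card_tables_rec)

text \<open>The places of the last two kinds are chosen together and then divided between them; the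
  factorization also shows that the division in \<open>multinomial3\<close> is exact.\<close>

lemma multinomial3_eq: "multinomial3 p s t = (p + s + t choose (s + t)) * (s + t choose s)"
proof -
  have 1: "fact (s + t) = fact s * fact t * (s + t choose s)"
    using binomial_fact_lemma[of s "s + t"] by simp
  have 2: "fact (p + s + t) = fact (s + t) * fact p * (p + s + t choose (s + t))"
    using binomial_fact_lemma[of "s + t" "p + s + t"] by (simp add: add.assoc)
  have "fact (p + s + t) = (fact p * fact s * fact t) * ((p + s + t choose (s + t)) * (s + t choose s))"
    by (simp add: 1 2 mult_ac)
  thus ?thesis unfolding multinomial3_def by simp
qed

text \<open>Terms are grouped by \<open>j = s + t\<close>. Summing \<open>j choose s\<close> over
  \<open>s\<close> gives \<open>2 ^ j\<close>, which raises the power of two from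
  \<open>N - 2 * j\<close> to \<open>N - j\<close>.\<close>

lemma sum_multinomial3:
  "(\<Sum>s = 0..N div 2. \<Sum>t = 0..N div 2 - s. 2 ^ (N - 2 * (s + t)) * multinomial3 (N - 2 * (s + t)) s t)
    = (\<Sum>j\<le>N. 2 ^ (N - j) * ((N - j) choose j))" (is "?L = _")
proof -
  let ?F = "\<lambda>s t. 2 ^ (N - 2 * (s + t)) * multinomial3 (N - 2 * (s + t)) s t"
  have "?L = (\<Sum>(s, t)\<in>(SIGMA s:{0..N div 2}. {0..N div 2 - s}). ?F s t)"
    by (rule sum.Sigma) auto
  also have "(SIGMA s:{0..N div 2}. {0..N div 2 - s}) = {(s, t). s + t \<le> N div 2}"
    by auto
  also have "(\<Sum>(s, t)\<in>{(s, t). s + t \<le> N div 2}. ?F s t) = (\<Sum>j\<le>N div 2. \<Sum>s\<le>j. ?F s (j - s))"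
    by (rule sum.triangle_reindex_eq)
  also have "\<dots> = (\<Sum>j\<le>N div 2. 2 ^ (N - j) * ((N - j) choose j))"
  proof (rule sum.cong[OF refl])
    fix j assume "j \<in> {..N div 2}"
    hence j: "2 * j \<le> N" by auto
    hence p: "N - 2 * j + j = N - j" by simp
    have "(\<Sum>s\<le>j. ?F s (j - s)) = (\<Sum>s\<le>j. 2 ^ (N - 2 * j) * ((N - j) choose j) * (j choose s))"
      by (rule sum.cong) (auto simp: multinomial3_eq p)
    also have "\<dots> = 2 ^ (N - 2 * j) * ((N - j) choose j) * 2 ^ j"
      by (simp only: sum_distrib_left[symmetric] choose_row_sum)
    also have "\<dots> = 2 ^ (N - 2 * j + j) * ((N - j) choose j)"
      by (simp add: power_add)
    finally show "(\<Sum>s\<le>j. ?F s (j - s)) = 2 ^ (N - j) * ((N - j) choose j)"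
      unfolding p .
  qed
  \<comment> \<open>For \<open>j > N div 2\<close> the lower index of the binomial exceeds the upper
    one, so the added terms vanish.\<close>
  also have "\<dots> = (\<Sum>j\<le>N. 2 ^ (N - j) * ((N - j) choose j))"
    by (rule sum.mono_neutral_left) (auto simp: binomial_eq_0_iff)
  finally show ?thesis .
qed

section \<open>Isomorphism classes of chains\<close>

context residuated_lattice
begin

lemma rle_refl: "x \<in> carrier A \<Longrightarrow> x \<preceq> x"
  using wedge_vee_absorb[of x "x \<curlywedge> x"] vee_wedge_absorb[of x x] wedge_closed[of x x]
  by (simp add: rle_def)

lemma rle_antisym: "\<lbrakk>x \<in> carrier A; y \<in> carrier A; x \<preceq> y; y \<preceq> x\<rbrakk> \<Longrightarrow> x = y"
  using wedge_comm[of x y] by (simp add: rle_def)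

lemma rle_trans:
  "\<lbrakk>x \<in> carrier A; y \<in> carrier A; z \<in> carrier A; x \<preceq> y; y \<preceq> z\<rbrakk> \<Longrightarrow> x \<preceq> z"
  using wedge_assoc[of x y z] by (simp add: rle_def)

lemma rle_iff_vee: "\<lbrakk>x \<in> carrier A; y \<in> carrier A\<rbrakk> \<Longrightarrow> x \<preceq> y \<longleftrightarrow> x \<curlyvee> y = y"
  using vee_wedge_absorb[of y x] wedge_vee_absorb[of x y] wedge_comm[of x y] vee_comm[of x y]
  unfolding rle_def by metis

lemma rle_wedge_iff:
  assumes c: "x \<in> carrier A" "y \<in> carrier A" "z \<in> carrier A"
  shows "z \<preceq> x \<curlywedge> y \<longleftrightarrow> z \<preceq> x \<and> z \<preceq> y"
proof
  assume z: "z \<preceq> x \<curlywedge> y"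
  have "(x \<curlywedge> y) \<curlywedge> y = x \<curlywedge> y" "(y \<curlywedge> x) \<curlywedge> x = y \<curlywedge> x"
    using c rle_refl wedge_assoc by (simp_all add: rle_def)
  hence "x \<curlywedge> y \<preceq> y" "x \<curlywedge> y \<preceq> x" using wedge_comm[of x y] c by (simp_all add: rle_def)
  thus "z \<preceq> x \<and> z \<preceq> y" using z c wedge_closed rle_trans by blast
next
  assume "z \<preceq> x \<and> z \<preceq> y"
  thus "z \<preceq> x \<curlywedge> y" using wedge_assoc[of z x y] c by (simp add: rle_def)
qed

lemma vee_rle_iff:
  assumes c: "x \<in> carrier A" "y \<in> carrier A" "z \<in> carrier A"
  shows "x \<curlyvee> y \<preceq> z \<longleftrightarrow> x \<preceq> z \<and> y \<preceq> z"
proof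
  assume z: "x \<curlyvee> y \<preceq> z"
  have "x \<preceq> x \<curlyvee> y" "y \<preceq> x \<curlyvee> y"
    using c wedge_vee_absorb[of x y] wedge_vee_absorb[of y x] vee_comm[of x y]
    by (simp_all add: rle_def)
  thus "x \<preceq> z \<and> y \<preceq> z" using z c vee_closed rle_trans by blast
next
  assume "x \<preceq> z \<and> y \<preceq> z"
  thus "x \<curlyvee> y \<preceq> z" using vee_assoc[of x y z] c by (simp add: rle_iff_vee vee_closed)
qed

lemma eq_by_lower_bounds:
  assumes "x \<in> carrier A" "y \<in> carrier A" "\<And>z. z \<in> carrier A \<Longrightarrow> z \<preceq> x \<longleftrightarrow> z \<preceq> y"
  shows "x = y"
  using assms rle_refl rle_antisym by blast

lemma eq_by_upper_bounds:
  assumes "x \<in> carrier A" "y \<in> carrier A" "\<And>z. z \<in> carrier A \<Longrightarrow> x \<preceq> z \<longleftrightarrow> y \<preceq> z"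
  shows "x = y"
  using assms rle_refl rle_antisym by blast

text \<open>Residuation yields \<open>y \<preceq> z \<setminus> (z \<otimes> y)\<close>; passing
  down to \<open>x\<close> and residuating back gives the inequality.\<close>

lemma mult_mono_right:
  assumes "x \<in> carrier A" "y \<in> carrier A" "z \<in> carrier A" "x \<preceq> y"
  shows "z \<otimes> x \<preceq> z \<otimes> y"
proof -
  have "y \<preceq> z \<setminus> (z \<otimes> y)" using assms by (simp add: under_residual rle_refl)
  hence "x \<preceq> z \<setminus> (z \<otimes> y)"
    using assms rle_trans[of x y] by (simp add: under_closed)
  thus ?thesis using assms by (simp add: under_residual)
qed

lemma mult_mono_left:
  assumes "x \<in> carrier A" "y \<in> carrier A" "z \<in> carrier A" "x \<preceq> y"
  shows "x \<otimes> z \<preceq> y \<otimes> z"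
proof -
  have "y \<preceq> (y \<otimes> z) \<oslash> z" using assms by (simp add: over_residual rle_refl)
  hence "x \<preceq> (y \<otimes> z) \<oslash> z"
    using assms rle_trans[of x y] by (simp add: over_closed)
  thus ?thesis using assms by (simp add: over_residual)
qed

end

text \<open>Meets, joins and both residuals are characterized by order and product alone, so
  comparing lower or upper bounds transfers them along \<open>f\<close>.\<close>

lemma rl_isoI:
  assumes "residuated_lattice A" "residuated_lattice B"
    and bij: "bij_betw f (carrier A) (carrier B)"
    and le: "\<And>x y. \<lbrakk>x \<in> carrier A; y \<in> carrier A\<rbrakk> \<Longrightarrow> f x \<preceq>\<^bsub>B\<^esub> f y \<longleftrightarrow> x \<preceq>\<^bsub>A\<^esub> y"
    and mult: "\<And>x y. \<lbrakk>x \<in> carrier A; y \<in> carrier A\<rbrakk> \<Longrightarrow> f (x \<otimes>\<^bsub>A\<^esub> y) = f x \<otimes>\<^bsub>B\<^esub> f y"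
  shows "f \<in> rl_iso A B"
proof -
  interpret A: residuated_lattice A by fact
  interpret B: residuated_lattice B by fact
  have cl: "f x \<in> carrier B" if "x \<in> carrier A" for x
    using bij that by (rule bij_betw_apply)
  have surj: "\<exists>x\<in>carrier A. z = f x" if "z \<in> carrier B" for z
    using bij that by (auto simp: bij_betw_def)
  \<comment> \<open>By surjectivity the image of the unit is a left unit of \<open>B\<close>, hence
    equal to the unit of \<open>B\<close>.\<close>
  have "f \<one>\<^bsub>A\<^esub> \<otimes>\<^bsub>B\<^esub> z = z" if z: "z \<in> carrier B" for z
    using surj[OF z] mult[of "\<one>\<^bsub>A\<^esub>"] by auto
  from this[of "\<one>\<^bsub>B\<^esub>"] have one: "f \<one>\<^bsub>A\<^esub> = \<one>\<^bsub>B\<^esub>" using cl by simp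
  have ops: "f (x \<curlywedge>\<^bsub>A\<^esub> y) = f x \<curlywedge>\<^bsub>B\<^esub> f y \<and> f (x \<curlyvee>\<^bsub>A\<^esub> y) = f x \<curlyvee>\<^bsub>B\<^esub> f y \<and>
      f (x \<setminus>\<^bsub>A\<^esub> y) = f x \<setminus>\<^bsub>B\<^esub> f y \<and> f (x \<oslash>\<^bsub>A\<^esub> y) = f x \<oslash>\<^bsub>B\<^esub> f y"
    if xy: "x \<in> carrier A" "y \<in> carrier A" for x y
  proof (intro conjI)
    note AB = A.wedge_closed A.vee_closed A.under_closed A.over_closed
      B.wedge_closed B.vee_closed B.under_closed B.over_closed cl xy le
    show "f (x \<curlywedge>\<^bsub>A\<^esub> y) = f x \<curlywedge>\<^bsub>B\<^esub> f y"
      by (rule B.eq_by_lower_bounds)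
        (auto dest!: surj simp: AB A.rle_wedge_iff B.rle_wedge_iff)
    show "f (x \<curlyvee>\<^bsub>A\<^esub> y) = f x \<curlyvee>\<^bsub>B\<^esub> f y"
      by (rule B.eq_by_upper_bounds)
        (auto dest!: surj simp: AB A.vee_rle_iff B.vee_rle_iff)
    show "f (x \<setminus>\<^bsub>A\<^esub> y) = f x \<setminus>\<^bsub>B\<^esub> f y"
      by (rule B.eq_by_lower_bounds)
        (auto dest!: surj simp: AB A.under_residual B.under_residual mult[symmetric])
    show "f (x \<oslash>\<^bsub>A\<^esub> y) = f x \<oslash>\<^bsub>B\<^esub> f y"
      by (rule B.eq_by_lower_bounds)
        (auto dest!: surj simp: AB A.over_residual B.over_residual mult[symmetric])
  qed
  show ?thesis
    using bij one ops mult cl by (auto simp: rl_iso_def iso_def hom_def)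
qed

section \<open>The table of a finite chain as a complete isomorphism invariant\<close>

definition rank :: "('a, 'm) residuated_algebra_scheme \<Rightarrow> 'a \<Rightarrow> nat"
  where "rank A x = card {y \<in> carrier A. y \<preceq>\<^bsub>A\<^esub> x \<and> y \<noteq> x}"

definition position :: "('a, 'm) residuated_algebra_scheme \<Rightarrow> 'a \<Rightarrow> int"
  where "position A x = int (rank A x) - int (rank A \<one>\<^bsub>A\<^esub>)"

definition position_range :: "('a, 'm) residuated_algebra_scheme \<Rightarrow> int set"
  where "position_range A = {- int (rank A \<one>\<^bsub>A\<^esub>)..int (card (carrier A)) - 1 - int (rank A \<one>\<^bsub>A\<^esub>)}"

text \<open>This is the product transported along \<open>position\<close>; the default 0 agrees with
  \<open>outside\<close> in \<open>idempotent_chain_table\<close>.\<close>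

definition position_mult ::
    "('a, 'm) residuated_algebra_scheme \<Rightarrow> int \<Rightarrow> int \<Rightarrow> int"
  where "position_mult A i j = (if i \<in> position_range A \<and> j \<in> position_range A
    then position A (inv_into (carrier A) (position A) i \<otimes>\<^bsub>A\<^esub> inv_into (carrier A) (position A) j)
    else 0)"

definition table ::
    "('a, 'm) residuated_algebra_scheme \<Rightarrow> int \<times> int \<times> (int \<Rightarrow> int \<Rightarrow> int)"
  where "table A = (- int (rank A \<one>\<^bsub>A\<^esub>), int (card (carrier A)) - 1 - int (rank A \<one>\<^bsub>A\<^esub>),
    position_mult A)"

lemma position_one: "position A \<one>\<^bsub>A\<^esub> = 0"
  by (simp add: position_def)

locale finite_residuated_chain = residuated_chain +
  assumes finite_carrier: "finite (carrier A)"
begin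

lemma rank_less:
  assumes "x \<in> carrier A" "y \<in> carrier A" "x \<preceq> y" "x \<noteq> y"
  shows "rank A x < rank A y"
  unfolding rank_def
proof (rule psubset_card_mono)
  show "finite {z \<in> carrier A. z \<preceq> y \<and> z \<noteq> y}" using finite_carrier by simp
  have "z \<preceq> y \<and> z \<noteq> y" if "z \<in> carrier A" "z \<preceq> x" "z \<noteq> x" for z
    using that assms rle_trans rle_antisym by blast
  thus "{z \<in> carrier A. z \<preceq> x \<and> z \<noteq> x} \<subset> {z \<in> carrier A. z \<preceq> y \<and> z \<noteq> y}"
    using assms by blast
qed

lemma rank_le_iff:
  assumes "x \<in> carrier A" "y \<in> carrier A"
  shows "rank A x \<le> rank A y \<longleftrightarrow> x \<preceq> y"
  using assms rank_less[of x y] rank_less[of y x] rle_total[of x y] rle_refl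
  by (metis leD less_imp_le order_refl)

lemma position_le_iff:
  "\<lbrakk>x \<in> carrier A; y \<in> carrier A\<rbrakk> \<Longrightarrow> position A x \<le> position A y \<longleftrightarrow> x \<preceq> y"
  by (simp add: position_def rank_le_iff)

text \<open>An injection into an interval with as many elements as the carrier is onto.\<close>

lemma bij_betw_position: "bij_betw (position A) (carrier A) (position_range A)"
  unfolding bij_betw_def
proof
  show inj: "inj_on (position A) (carrier A)"
    by (rule inj_onI) (metis position_le_iff order_refl rle_antisym)
  have "rank A x < card (carrier A)" if "x \<in> carrier A" for x
    unfolding rank_def by (rule psubset_card_mono) (use that finite_carrier in auto)
  hence "position A x \<in> position_range A" if "x \<in> carrier A" for x
    using that by (fastforce simp: position_def position_range_def)
  moreover have "card (position_range A) = card (carrier A)"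
    by (simp add: position_range_def)
  ultimately show "position A ` carrier A = position_range A"
    using card_image[OF inj] by (intro card_subset_eq) (auto simp: position_range_def)
qed

lemma position_mult:
  assumes "x \<in> carrier A" "y \<in> carrier A"
  shows "position_mult A (position A x) (position A y) = position A (x \<otimes> y)"
  using assms bij_betw_position
  by (auto simp: position_mult_def bij_betw_def inv_into_f_f)

lemma position_cases:
  assumes "i \<in> position_range A"
  obtains x where "x \<in> carrier A" "i = position A x"
  using assms bij_betw_position by (auto simp: bij_betw_def)

lemma position_in: "x \<in> carrier A \<Longrightarrow> position A x \<in> position_range A"
  using bij_betw_position by (rule bij_betw_apply)

end

text \<open>An isomorphism preserves meets, hence the order, the ranks and the place of the unit;
  positions therefore agree along it.\<close>

lemma table_rl_iso:
  assumes "finite_residuated_chain A" "finite_residuated_chain B" "f \<in> rl_iso A B"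
  shows "table A = table B"
proof -
  interpret A: finite_residuated_chain A by fact
  interpret B: finite_residuated_chain B by fact
  have bij: "bij_betw f (carrier A) (carrier B)"
    using assms(3) by (simp add: rl_iso_def iso_def)
  have hom: "f (x \<otimes>\<^bsub>A\<^esub> y) = f x \<otimes>\<^bsub>B\<^esub> f y" if "x \<in> carrier A" "y \<in> carrier A" for x y
    using that assms(3) by (simp add: rl_iso_def iso_def hom_def)
  have cl: "f x \<in> carrier B" if "x \<in> carrier A" for x
    using bij that by (rule bij_betw_apply)
  have inj: "f x = f y \<longleftrightarrow> x = y" if "x \<in> carrier A" "y \<in> carrier A" for x y
    using bij that by (auto simp: bij_betw_def inj_on_def)
  have one: "f \<one>\<^bsub>A\<^esub> = \<one>\<^bsub>B\<^esub>" using assms(3) by (simp add: rl_iso_def)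
  have le: "f x \<preceq>\<^bsub>B\<^esub> f y \<longleftrightarrow> x \<preceq>\<^bsub>A\<^esub> y" if "x \<in> carrier A" "y \<in> carrier A" for x y
  proof -
    have "f (x \<curlywedge>\<^bsub>A\<^esub> y) = f x \<curlywedge>\<^bsub>B\<^esub> f y" using that assms(3) by (simp add: rl_iso_def)
    thus ?thesis using inj[OF A.wedge_closed[OF that] that(1)] by (simp add: rle_def)
  qed
  have rank: "rank B (f x) = rank A x" if "x \<in> carrier A" for x
  proof -
    have "bij_betw f {y \<in> carrier A. y \<preceq>\<^bsub>A\<^esub> x \<and> y \<noteq> x} {y \<in> carrier B. y \<preceq>\<^bsub>B\<^esub> f x \<and> y \<noteq> f x}"
      using bij
    proof (rule bij_betw_subset)
      have "\<exists>z\<in>carrier A. y = f z" if "y \<in> carrier B" for y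
        using bij that by (auto simp: bij_betw_def)
      thus "f ` {y \<in> carrier A. y \<preceq>\<^bsub>A\<^esub> x \<and> y \<noteq> x} = {y \<in> carrier B. y \<preceq>\<^bsub>B\<^esub> f x \<and> y \<noteq> f x}"
        using cl le inj that by fastforce
    qed blast
    thus ?thesis unfolding rank_def by (rule bij_betw_same_card[symmetric])
  qed
  have rank_one: "rank B \<one>\<^bsub>B\<^esub> = rank A \<one>\<^bsub>A\<^esub>" using rank[OF A.one_closed] one by simp
  have pos: "position B (f x) = position A x" if "x \<in> carrier A" for x
    using rank[OF that] rank_one by (simp add: position_def)
  have card: "card (carrier B) = card (carrier A)"
    using bij_betw_same_card[OF bij] by simp
  have range: "position_range B = position_range A"
    by (simp add: position_range_def card rank_one)
  have "position_mult A i j = position_mult B i j" for i j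
  proof (cases "i \<in> position_range A \<and> j \<in> position_range A")
    case True
    then obtain x y where "x \<in> carrier A" "y \<in> carrier A" "i = position A x" "j = position A y"
      using A.position_cases by metis
    thus ?thesis
      using A.position_mult[of x y] B.position_mult[of "f x" "f y"] pos cl
      by (simp flip: hom)
  next
    case False
    thus ?thesis by (auto simp: position_mult_def range)
  qed
  thus ?thesis by (simp add: table_def card rank_one fun_eq_iff)
qed

text \<open>Equal tables have the same position range, so the position map of \<open>A\<close> can
  be followed by the inverse of that of \<open>B\<close>. This preserves order and product, and
  \<open>rl_isoI\<close> supplies the rest.\<close>

lemma table_eq_imp_rl_iso:
  assumes "finite_residuated_chain A" "finite_residuated_chain B" "table A = table B"
  shows "rl_iso A B \<noteq> {}"
proof -
  interpret A: finite_residuated_chain A by fact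
  interpret B: finite_residuated_chain B by fact
  have range: "position_range A = position_range B" and mult: "position_mult A = position_mult B"
    using assms(3) by (simp_all add: table_def position_range_def)
  define f where "f = inv_into (carrier B) (position B) \<circ> position A"
  have bij: "bij_betw f (carrier A) (carrier B)"
    unfolding f_def
    by (rule bij_betw_trans[OF A.bij_betw_position])
      (simp add: range bij_betw_inv_into B.bij_betw_position)
  have pos: "position B (f x) = position A x" if "x \<in> carrier A" for x
    using A.position_in[OF that] B.bij_betw_position
    by (simp add: f_def range bij_betw_inv_into_right)
  have cl: "f x \<in> carrier B" if "x \<in> carrier A" for x
    using bij that by (rule bij_betw_apply)
  have "f \<in> rl_iso A B"
  proof (rule rl_isoI)
    show "residuated_lattice A" "residuated_lattice B" by unfold_locales
    show "bij_betw f (carrier A) (carrier B)" by (rule bij)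
    fix x y assume xy: "x \<in> carrier A" "y \<in> carrier A"
    show "f x \<preceq>\<^bsub>B\<^esub> f y \<longleftrightarrow> x \<preceq>\<^bsub>A\<^esub> y"
      using xy cl pos A.position_le_iff B.position_le_iff by metis
    have "position B (f (x \<otimes>\<^bsub>A\<^esub> y)) = position B (f x \<otimes>\<^bsub>B\<^esub> f y)"
      using xy cl pos A.position_mult[of x y] B.position_mult[of "f x" "f y"] mult by simp
    thus "f (x \<otimes>\<^bsub>A\<^esub> y) = f x \<otimes>\<^bsub>B\<^esub> f y"
      using B.bij_betw_position xy cl by (auto simp: bij_betw_def inj_on_def)
  qed
  thus ?thesis by blast
qed

text \<open>Residuation makes the bottom a zero, which by \<open>peelable_bottom\<close> has to be
  checked only against the top.\<close>

lemma (in idempotent_residuated_chain) table_peelable: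
  assumes fin: "finite (carrier A)" and card: "card (carrier A) = Suc (Suc N)"
  shows "table A \<in> peelable 1 0 (Suc N)"
proof -
  interpret finite_residuated_chain A
    by unfold_locales (rule fin)
  define l h where "l = - int (rank A \<one>)" and "h = int (card (carrier A)) - 1 - int (rank A \<one>)"
  have range: "position_range A = {l..h}" by (simp add: position_range_def l_def h_def)
  let ?f = "position_mult A"
  have lh: "l \<le> 0" "0 \<le> h" "h - l = int (Suc N)"
    using position_in[OF one_closed] by (auto simp: l_def h_def card range position_one)
  have table: "idempotent_chain_table l h ?f"
  proof
    fix x y z assume "x \<in> {l..h}" "y \<in> {l..h}" "z \<in> {l..h}"
    then obtain x' y' z' where xyz: "x' \<in> carrier A" "y' \<in> carrier A" "z' \<in> carrier A"
      "x = position A x'" "y = position A y'" "z = position A z'"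
      using position_cases unfolding range by metis
    show "?f (?f x y) z = ?f x (?f y z)"
      using xyz by (simp add: position_mult m_assoc)
    assume "x \<le> y"
    thus "?f x z \<le> ?f y z" "?f z x \<le> ?f z y"
      using xyz by (simp_all add: position_mult position_le_iff mult_mono_left mult_mono_right)
  next
    fix x y assume "x \<in> {l..h}" "y \<in> {l..h}"
    then obtain x' y' where xy: "x' \<in> carrier A" "y' \<in> carrier A"
      "x = position A x'" "y = position A y'"
      using position_cases unfolding range by metis
    show "?f x y \<in> {l..h}"
      using xy position_in[of "x' \<otimes> y'"] by (simp add: position_mult range)
  next
    fix x assume "x \<in> {l..h}"
    then obtain x' where x: "x' \<in> carrier A" "x = position A x'"
      using position_cases unfolding range by metis
    show "?f x x = x" "?f 0 x = x" "?f x 0 = x"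
      using x idempotent position_mult[of x' x'] position_mult[of "\<one>" x'] position_mult[of x' "\<one>"]
      by (simp_all add: position_one)
  next
    fix x y assume "\<not> (x \<in> {l..h} \<and> y \<in> {l..h})"
    thus "?f x y = 0" by (simp only: position_mult_def range if_False)
  qed (use lh in auto)
  then interpret T: idempotent_chain_table l h ?f .
  have "l \<in> position_range A" "h \<in> position_range A" using lh by (auto simp: range)
  then obtain b t where bt: "b \<in> carrier A" "t \<in> carrier A" "l = position A b" "h = position A t"
    using position_cases by metis
  have bot: "b \<preceq> x" if "x \<in> carrier A" for x
    using position_in[OF that] position_le_iff[OF bt(1) that] bt(3) by (simp add: range)
  \<comment> \<open>The bottom lies below the residuals \<open>t \<setminus> b\<close> and
    \<open>b \<oslash> t\<close>; residuating gives these inequalities.\<close>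
  have "t \<otimes> b \<preceq> b" "b \<otimes> t \<preceq> b"
    using bot[of "t \<setminus> b"] bot[of "b \<oslash> t"] bt under_closed over_closed
      under_residual[of t b b] over_residual[of b t b] by auto
  hence "t \<otimes> b = b" "b \<otimes> t = b"
    using bot[of "t \<otimes> b"] bot[of "b \<otimes> t"] bt rle_antisym by auto
  hence "?f l h = l" "?f h l = l"
    using bt position_mult[of b t] position_mult[of t b] by simp_all
  thus ?thesis
    unfolding peelable_bottom table_def using table lh by (simp add: tables_def l_def h_def)
qed

section \<open>Realizing tables by residuated chains, and the final count\<close>

definition table_chain :: "int \<Rightarrow> int \<Rightarrow> (int \<Rightarrow> int \<Rightarrow> int) \<Rightarrow> int residuated_algebra"
  where "table_chain l h f = \<lparr>carrier = {l..h}, mult = f, one = 0, wedge = min, vee = max,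
    under = (\<lambda>a c. Max {b \<in> {l..h}. f a b \<le> c}), over = (\<lambda>c b. Max {a \<in> {l..h}. f a b \<le> c})\<rparr>"

text \<open>A zero at the bottom belongs to each set whose maximum defines a residual, so these sets
  are nonempty. Monotonicity makes them downward closed, which gives the residuation laws.\<close>

lemma (in idempotent_chain_table) table_chain:
  assumes bot: "\<And>x. x \<in> {l..h} \<Longrightarrow> f l x = l" "\<And>x. x \<in> {l..h} \<Longrightarrow> f x l = l"
  shows "idempotent_residuated_chain (table_chain l h f)"
proof -
  let ?A = "table_chain l h f"
  have le: "x \<preceq>\<^bsub>?A\<^esub> y \<longleftrightarrow> x \<le> y" for x y
    by (simp add: rle_def table_chain_def min_def)
  have l: "l \<in> {l..h}" using bounds by simp
  have fin: "finite {b \<in> {l..h}. P b}" for P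
    by (rule finite_subset[of _ "{l..h}"]) auto
  have under_mem: "Max {b \<in> {l..h}. f a b \<le> c} \<in> {b \<in> {l..h}. f a b \<le> c}"
    if "a \<in> {l..h}" "c \<in> {l..h}" for a c
  proof (rule Max_in[OF fin])
    have "l \<in> {b \<in> {l..h}. f a b \<le> c}" using that l bot by simp
    thus "{b \<in> {l..h}. f a b \<le> c} \<noteq> {}" by blast
  qed
  have over_mem: "Max {a \<in> {l..h}. f a b \<le> c} \<in> {a \<in> {l..h}. f a b \<le> c}"
    if "b \<in> {l..h}" "c \<in> {l..h}" for b c
  proof (rule Max_in[OF fin])
    have "l \<in> {a \<in> {l..h}. f a b \<le> c}" using that l bot by simp
    thus "{a \<in> {l..h}. f a b \<le> c} \<noteq> {}" by blast
  qed
  have under: "b \<le> Max {b \<in> {l..h}. f a b \<le> c} \<longleftrightarrow> f a b \<le> c"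
    if "a \<in> {l..h}" "b \<in> {l..h}" "c \<in> {l..h}" for a b c
  proof
    assume "b \<le> Max {b \<in> {l..h}. f a b \<le> c}"
    moreover have "Max {b \<in> {l..h}. f a b \<le> c} \<in> {l..h}" "f a (Max {b \<in> {l..h}. f a b \<le> c}) \<le> c"
      using under_mem[of a c] that by simp_all
    ultimately show "f a b \<le> c"
      using mono_right[of b "Max {b \<in> {l..h}. f a b \<le> c}" a] that by (blast intro: order_trans)
  next
    assume "f a b \<le> c"
    thus "b \<le> Max {b \<in> {l..h}. f a b \<le> c}" using that by (intro Max_ge[OF fin]) simp
  qed
  have over: "a \<le> Max {a \<in> {l..h}. f a b \<le> c} \<longleftrightarrow> f a b \<le> c"
    if "a \<in> {l..h}" "b \<in> {l..h}" "c \<in> {l..h}" for a b c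
  proof
    assume "a \<le> Max {a \<in> {l..h}. f a b \<le> c}"
    moreover have "Max {a \<in> {l..h}. f a b \<le> c} \<in> {l..h}" "f (Max {a \<in> {l..h}. f a b \<le> c}) b \<le> c"
      using over_mem[of b c] that by simp_all
    ultimately show "f a b \<le> c"
      using mono_left[of a "Max {a \<in> {l..h}. f a b \<le> c}" b] that by (blast intro: order_trans)
  next
    assume "f a b \<le> c"
    thus "a \<le> Max {a \<in> {l..h}. f a b \<le> c}" using that by (intro Max_ge[OF fin]) simp
  qed
  have monoid: "monoid ?A"
    by unfold_locales
      (use closed assoc zero_mem unit_left unit_right in \<open>auto simp: table_chain_def\<close>)
  have c: "carrier ?A = {l..h}" "x \<otimes>\<^bsub>?A\<^esub> y = f x y" "x \<curlywedge>\<^bsub>?A\<^esub> y = min x y"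
    "x \<curlyvee>\<^bsub>?A\<^esub> y = max x y" "x \<setminus>\<^bsub>?A\<^esub> y = Max {b \<in> {l..h}. f x b \<le> y}"
    "x \<oslash>\<^bsub>?A\<^esub> y = Max {a \<in> {l..h}. f a y \<le> x}" for x y
    by (simp_all add: table_chain_def)
  have "residuated_lattice ?A"
  proof (intro residuated_lattice.intro monoid, unfold residuated_lattice_axioms_def c le,
      intro conjI allI impI)
    fix x y assume "x \<in> {l..h}" "y \<in> {l..h}"
    thus "Max {b \<in> {l..h}. f x b \<le> y} \<in> {l..h}" "Max {a \<in> {l..h}. f a y \<le> x} \<in> {l..h}"
      using under_mem[of x y] over_mem[of y x] by blast+
  qed (use under over in \<open>auto simp: min_def max_def\<close>)
  thus ?thesis
    using idem
    by (auto simp: idempotent_residuated_chain_def residuated_chain_def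
        residuated_chain_axioms_def idempotent_residuated_chain_axioms_def c le)
qed

text \<open>The carrier is already an integer interval with unit 0, so every element is its own
  position.\<close>

lemma (in idempotent_chain_table) table_table_chain:
  assumes chain: "idempotent_residuated_chain (table_chain l h f)"
  shows "table (table_chain l h f) = (l, h, f)"
proof -
  let ?A = "table_chain l h f"
  interpret A: idempotent_residuated_chain ?A by fact
  interpret A: finite_residuated_chain ?A
    by unfold_locales (simp add: table_chain_def)
  have rank: "rank ?A x = nat (x - l)" if "x \<in> {l..h}" for x
  proof -
    have "{y \<in> carrier ?A. y \<preceq>\<^bsub>?A\<^esub> x \<and> y \<noteq> x} = {l..<x}"
      using that by (auto simp: table_chain_def rle_def)
    thus ?thesis by (simp add: rank_def)
  qed
  have one: "rank ?A \<one>\<^bsub>?A\<^esub> = nat (- l)"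
    using rank[OF zero_mem] by (simp add: table_chain_def)
  have pos: "position ?A x = x" if "x \<in> {l..h}" for x
    using rank[OF that] one that bounds by (simp add: position_def)
  have card: "card (carrier ?A) = nat (h - l + 1)" by (simp add: table_chain_def)
  have range: "position_range ?A = {l..h}"
    using bounds by (auto simp: position_range_def one card)
  have "position_mult ?A x y = f x y" for x y
  proof (cases "x \<in> {l..h} \<and> y \<in> {l..h}")
    case True
    thus ?thesis
      using A.position_mult[of x y] pos closed[of x y] by (simp add: table_chain_def)
  next
    case False
    thus ?thesis using outside[OF False] by (simp only: position_mult_def range if_False)
  qed
  thus ?thesis using bounds by (simp add: table_def one card fun_eq_iff)
qed

lemma irc_n_finite_chain: "A \<in> irc_n n \<Longrightarrow> finite_residuated_chain A"
  by (auto simp: irc_n_def finite_residuated_chain_def finite_residuated_chain_axioms_def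
      idempotent_residuated_chain_def)

lemma table_image_irc_n: "table ` irc_n (Suc (Suc N)) = peelable 1 0 (Suc N)"
proof
  show "table ` irc_n (Suc (Suc N)) \<subseteq> peelable 1 0 (Suc N)"
    using idempotent_residuated_chain.table_peelable by (auto simp: irc_n_def)
  show "peelable 1 0 (Suc N) \<subseteq> table ` irc_n (Suc (Suc N))"
  proof
    fix T assume "T \<in> peelable 1 0 (Suc N)"
    then obtain l h f where T: "T = (l, h, f)" "(l, h, f) \<in> tables (Suc N)" "f l h = l" "f h l = l"
      unfolding peelable_bottom by auto
    then interpret idempotent_chain_table l h f by (simp add: tables_def)
    have lh: "h - l = int (Suc N)" using T by (simp add: tables_def)
    let ?A = "table_chain l h f"
    have chain: "idempotent_residuated_chain ?A"
      using corners_bottom T lh by (intro table_chain) auto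
    then interpret A: idempotent_residuated_chain ?A .
    have fin: "finite (carrier ?A)" "card (carrier ?A) = Suc (Suc N)"
      using lh by (simp_all add: table_chain_def)
    \<comment> \<open>The chain \<open>?A\<close> consists of integers and is replaced by an
      isomorphic copy on natural numbers, which has the same table. From here on \<open>f\<close>
      denotes the isomorphism, no longer the multiplication.\<close>
    then obtain B f where B: "B \<in> irc_n (Suc (Suc N))" "f \<in> rl_iso ?A B"
      using A.residuated_chain_on_nat by blast
    have "finite_residuated_chain ?A"
      by unfold_locales (rule fin)
    hence "table B = table ?A"
      using table_rl_iso[OF _ irc_n_finite_chain[OF B(1)] B(2)] by simp
    thus "T \<in> table ` irc_n (Suc (Suc N))"
      using B(1) T(1) table_table_chain[OF chain] by (metis image_eqI)
  qed
qed

text \<open>Maps with the same kernel have equally many values. This compares the map to isomorphism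
  classes with \<open>table\<close>.\<close>

lemma card_image_cong_kernel:
  assumes "\<And>x y. \<lbrakk>x \<in> S; y \<in> S\<rbrakk> \<Longrightarrow> f x = f y \<longleftrightarrow> g x = g y"
  shows "card (f ` S) = card (g ` S)"
proof -
  have g: "g (inv_into S f (f x)) = g x" if "x \<in> S" for x
    using assms[of "inv_into S f (f x)" x] that by (simp add: inv_into_into f_inv_into_f)
  have "bij_betw (\<lambda>a. g (inv_into S f a)) (f ` S) (g ` S)"
    unfolding bij_betw_def inj_on_def image_image using g assms by auto
  thus ?thesis by (rule bij_betw_same_card)
qed

text \<open>Classes correspond to tables whose bottom is a zero; removing that zero leaves an
  arbitrary table with one element fewer.\<close>

lemma num_irc_eq_card_tables: "num_irc (Suc (Suc N)) = card (tables N)"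
proof -
  let ?S = "irc_n (Suc (Suc N))" and ?R = "irc_iso_rel (Suc (Suc N))"
  have "?R `` {A} = ?R `` {B} \<longleftrightarrow> table A = table B" if "A \<in> ?S" "B \<in> ?S" for A B
  proof -
    have "?R `` {A} = ?R `` {B} \<longleftrightarrow> rl_iso A B \<noteq> {}"
      using eq_equiv_class_iff[OF equiv_irc_iso_rel that] that by (simp add: irc_iso_rel_def)
    also have "\<dots> \<longleftrightarrow> table A = table B"
      using that[THEN irc_n_finite_chain] table_rl_iso table_eq_imp_rl_iso by blast
    finally show ?thesis .
  qed
  hence "card ((\<lambda>A. ?R `` {A}) ` ?S) = card (table ` ?S)"
    by (rule card_image_cong_kernel)
  moreover have "?S // ?R = (\<lambda>A. ?R `` {A}) ` ?S" by (auto simp: quotient_def)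
  moreover have "card (peelable 1 0 (Suc N)) = card (tables N)"
    using bij_betw_same_card[OF bij_betw_peel[of 1 0 N]] by simp
  ultimately show ?thesis
    unfolding num_irc_def by (simp only: table_image_irc_n)
qed

theorem theorem4p4:
  fixes n :: nat
  assumes "n \<ge> 2"
  shows "num_irc n =
    (\<Sum>s = 0..n div 2 - 1. \<Sum>t = 0..n div 2 - 1 - s.
       2 ^ (n - 2 * (1 + s + t)) * multinomial3 (n - 2 * (1 + s + t)) s t)"
proof -
  obtain N where n: "n = Suc (Suc N)"
    using assms by (metis Suc_le_D numeral_2_eq_2 Suc_le_mono)
  have "n - 2 * (1 + s + t) = N - 2 * (s + t)" for s t by (simp add: n)
  moreover have "n div 2 - 1 = N div 2" by (simp add: n)
  ultimately show ?thesis
    using num_irc_eq_card_tables[of N] card_tables[of N] sum_multinomial3[of N] by (simp only: n)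
qed

end
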